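(* Let $(M,d,f)$ be an augmented metric space with density-Rips persistent set $S$, and let $x\in M$ be a point. If there exists some other point $y\in M$, $y\neq x$, such that (i) $f(y)\le f(x)$, and (ii) for every graph $\mathcal{G}_\varepsilon(M_\sigma)$ (with $\varepsilon\ge0$, $\sigma\in\mathbb{R}$), if $x$ is path-connected in it to some point other than $x$, then $x$ is path-connected in it to $y$, then the generator $(p_x,x)$ of $S$ corresponding to $x$ is a rooted generator. Conversely, if $x$ is a rooted generator of $S$, then there exists a point $y\in M$, $y\ne x$, satisfying (i) and (ii).
   Context: Let $P$ be a finite poset, viewed as a category. A persistent set over $P$ is a functor $S\colon P\to\mathsf{Set}$ to finite sets, with maps $S_{p\to q}\colon S_p\to S_q$ for $p\le q$; morphisms are natural transformations. An endomorphism $\varphi$ is idempotent if $\varphi\circ\varphi=\varphi$. A generator of $S$ is a pair $(p_x,x)$ with $x\in S_{p_x}$ such that $x$ is not in the image of $S_{q\to p_x}$ for any $q<p_x$. A generator $(p_x,x)$ is fixed by an endomorphism $\varphi$ of $S$ if $\varphi_{p_x}(x)=x$. A rooted subset of $S$ is a non-empty subset $A$ of the generators of $S$ such that there is an idempotent endomorphism $\varphi$ of $S$ whose set of generators that are not fixed is precisely $A$. If $A=\{x\}$ is a rooted subset, $x$ is called a rooted generator. An augmented metric space is a triple $(M,d,f)$ with $(M,d)$ a finite metric space and $f\colon M\to\mathbb{R}$ a function. For $\sigma\in\mathbb{R}$ put $M_\sigma:=\{x\in M: f(x)\le\sigma\}$. For a finite metric space $N$ and $\varepsilon\ge 0$,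 $\mathcal{G}_\varepsilon(N)$ is the undirected graph with vertex set $N$ and an edge between $x,y$ whenever $d(x,y)\le\varepsilon$. Put $P:=D\times T\subset\mathbb{R}_{\ge0}\times\mathbb{R}$ with $D:=\{d(x,y):x,y\in M\}$ and $T:=\{f(x):x\in M\}$, ordered by $(\varepsilon,\sigma)\le(\varepsilon',\sigma')$ iff $\varepsilon\le\varepsilon'$ and $\sigma\le\sigma'$. The density-Rips persistent set of $(M,d,f)$ is the functor $S\colon P\to\mathsf{Set}$ sending $(\varepsilon,\sigma)$ to the set of connected components of $\mathcal{G}_\varepsilon(M_\sigma)$, with maps induced by the inclusions of graphs. Points of $M$ correspond bijectively to generators of $S$: the point $x\in M$ corresponds to the generator $(p_x,x)$ with $p_x=(0,f(x))$, given by the connected component $\{x\}$ of $\mathcal{G}_0(M_{f(x)})$. Points are identified with their generators. *)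

theory Defs
  imports
    "HOL-Analysis.Abstract_Metric_Spaces"
    "HOL-Library.Product_Order"
    "HOL-Library.FuncSet"
    "Graph_Theory.Digraph_Component"
begin

(* A functor from a finite poset to finite sets: idx is the poset, with the order of the
   type class, obj p is the set at p, and tr p q is the map obj p -> obj q for p <= q.
   Values of tr and of endomorphisms outside the relevant sets carry no meaning. *)
record ('p, 's) pset =
  idx :: "'p set"
  obj :: "'p \<Rightarrow> 's set"
  tr :: "'p \<Rightarrow> 'p \<Rightarrow> 's \<Rightarrow> 's"

definition persistent_set :: "('p::order, 's) pset \<Rightarrow> bool" where
  "persistent_set S \<longleftrightarrow>
     finite (idx S) \<and>
     (\<forall>p\<in>idx S. finite (obj S p)) \<and>
     (\<forall>p\<in>idx S. \<forall>q\<in>idx S. p \<le> q \<longrightarrow> tr S p q \<in> obj S p \<rightarrow> obj S q) \<and>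
     (\<forall>p\<in>idx S. \<forall>x\<in>obj S p. tr S p p x = x) \<and>
     (\<forall>p\<in>idx S. \<forall>q\<in>idx S. \<forall>r\<in>idx S. p \<le> q \<longrightarrow> q \<le> r \<longrightarrow>
        (\<forall>x\<in>obj S p. tr S q r (tr S p q x) = tr S p r x))"

definition endomorphism :: "('p::order, 's) pset \<Rightarrow> ('p \<Rightarrow> 's \<Rightarrow> 's) \<Rightarrow> bool" where
  "endomorphism S \<phi> \<longleftrightarrow>
     (\<forall>p\<in>idx S. \<phi> p \<in> obj S p \<rightarrow> obj S p) \<and>
     (\<forall>p\<in>idx S. \<forall>q\<in>idx S. p \<le> q \<longrightarrow> (\<forall>x\<in>obj S p. \<phi> q (tr S p q x) = tr S p q (\<phi> p x)))"

definition idempotent_endomorphism :: "('p::order, 's) pset \<Rightarrow> ('p \<Rightarrow> 's \<Rightarrow> 's) \<Rightarrow> bool" where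
  "idempotent_endomorphism S \<phi> \<longleftrightarrow>
     endomorphism S \<phi> \<and> (\<forall>p\<in>idx S. \<forall>x\<in>obj S p. \<phi> p (\<phi> p x) = \<phi> p x)"

definition generators :: "('p::order, 's) pset \<Rightarrow> ('p \<times> 's) set" where
  "generators S =
     {(p, x). p \<in> idx S \<and> x \<in> obj S p \<and> (\<forall>q\<in>idx S. q < p \<longrightarrow> x \<notin> tr S q p ` obj S q)}"

definition fixed_by :: "('p \<Rightarrow> 's \<Rightarrow> 's) \<Rightarrow> 'p \<times> 's \<Rightarrow> bool" where
  "fixed_by \<phi> g \<longleftrightarrow> \<phi> (fst g) (snd g) = snd g"

definition rooted_subset :: "('p::order, 's) pset \<Rightarrow> ('p \<times> 's) set \<Rightarrow> bool" where
  "rooted_subset S A \<longleftrightarrow>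
     A \<noteq> {} \<and> A \<subseteq> generators S \<and>
     (\<exists>\<phi>. idempotent_endomorphism S \<phi> \<and> {g \<in> generators S. \<not> fixed_by \<phi> g} = A)"

definition rooted_generator :: "('p::order, 's) pset \<Rightarrow> 'p \<times> 's \<Rightarrow> bool" where
  "rooted_generator S g \<longleftrightarrow> rooted_subset S {g}"

definition sublevel :: "'a set \<Rightarrow> ('a \<Rightarrow> real) \<Rightarrow> real \<Rightarrow> 'a set" where
  "sublevel M f \<sigma> = {x \<in> M. f x \<le> \<sigma>}"

(* An undirected graph is a symmetric digraph, as in Graph_Theory; loops are left out. *)
definition rips_graph ::
  "('a \<Rightarrow> 'a \<Rightarrow> real) \<Rightarrow> real \<Rightarrow> 'a set \<Rightarrow> ('a, 'a \<times> 'a) pre_digraph" where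
  "rips_graph d \<epsilon> N =
     \<lparr> verts = N, arcs = {(x, y). x \<in> N \<and> y \<in> N \<and> x \<noteq> y \<and> d x y \<le> \<epsilon>},
       tail = fst, head = snd \<rparr>"

(* In a symmetric digraph the strongly connected components are the connected components of
   the undirected graph. The map induced by an inclusion of graphs sends a component C to the
   component of the larger graph that contains C, which is the component of each x in C. The
   order on index pairs is the componentwise one of HOL-Library.Product_Order. *)
definition density_rips ::
  "'a set \<Rightarrow> ('a \<Rightarrow> 'a \<Rightarrow> real) \<Rightarrow> ('a \<Rightarrow> real) \<Rightarrow> (real \<times> real, 'a set) pset" where
  "density_rips M d f =
     \<lparr> idx = {d x y | x y. x \<in> M \<and> y \<in> M} \<times> f ` M,
       obj = (\<lambda>(\<epsilon>, \<sigma>). pre_digraph.sccs_verts (rips_graph d \<epsilon> (sublevel M f \<sigma>))),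
       tr = (\<lambda>p (\<epsilon>, \<sigma>) C. \<Union>x\<in>C. pre_digraph.scc_of (rips_graph d \<epsilon> (sublevel M f \<sigma>)) x) \<rparr>"

definition point_generator :: "('a \<Rightarrow> real) \<Rightarrow> 'a \<Rightarrow> (real \<times> real) \<times> 'a set" where
  "point_generator f x = ((0, f x), {x})"

lemma graph_rips_graph:
  assumes "Metric_space M d" "finite N"
  shows "graph (rips_graph d \<epsilon> N)"
proof -
  have c: "d x y = d y x" for x y using assms(1) by (simp add: Metric_space_def)
  have "finite {(x, y). x \<in> N \<and> y \<in> N \<and> x \<noteq> y \<and> d x y \<le> \<epsilon>}"
    by (rule finite_subset[of _ "N \<times> N"]) (use assms(2) in auto)
  with assms(2) c show ?thesis
    by unfold_locales
      (auto simp: rips_graph_def arc_to_ends_def symmetric_def arcs_ends_def sym_def image_iff)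
qed

lemma rips_graph_reachable_mono:
  assumes "Metric_space M d" "finite N'" "N \<subseteq> N'" "\<epsilon> \<le> \<epsilon>'"
    and "reachable (rips_graph d \<epsilon> N) x y"
  shows "reachable (rips_graph d \<epsilon>' N') x y"
proof -
  have "finite N" using assms(2,3) finite_subset by blast
  then interpret g: graph "rips_graph d \<epsilon> N" using graph_rips_graph assms by blast
  interpret h: graph "rips_graph d \<epsilon>' N'" using graph_rips_graph assms by blast
  have "arcs_ends (rips_graph d \<epsilon> N) \<subseteq> arcs_ends (rips_graph d \<epsilon>' N')"
    using assms(3,4) by (auto simp: rips_graph_def arcs_ends_def arc_to_ends_def image_iff)
  moreover have "verts (rips_graph d \<epsilon> N) \<subseteq> verts (rips_graph d \<epsilon>' N')"
    using assms(3) by (simp add: rips_graph_def)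
  ultimately show ?thesis using assms(5)
    by (metis reachable_def rtrancl_on_mono)
qed

lemma density_rips_tr_scc_of:
  assumes m: "Metric_space M d" and fin: "finite M"
    and le: "(\<epsilon>, \<sigma>) \<le> (\<epsilon>', \<sigma>')" and x: "x \<in> sublevel M f \<sigma>"
  shows "tr (density_rips M d f) (\<epsilon>, \<sigma>) (\<epsilon>', \<sigma>')
           (pre_digraph.scc_of (rips_graph d \<epsilon> (sublevel M f \<sigma>)) x)
         = pre_digraph.scc_of (rips_graph d \<epsilon>' (sublevel M f \<sigma>')) x"
proof -
  have fs: "finite (sublevel M f s)" for s using fin by (simp add: sublevel_def)
  interpret g: graph "rips_graph d \<epsilon> (sublevel M f \<sigma>)" using graph_rips_graph[OF m fs] .
  interpret h: graph "rips_graph d \<epsilon>' (sublevel M f \<sigma>')" using graph_rips_graph[OF m fs] .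
  have sub: "sublevel M f \<sigma> \<subseteq> sublevel M f \<sigma>'" using le by (auto simp: sublevel_def)
  have xg: "x \<in> verts (rips_graph d \<epsilon> (sublevel M f \<sigma>))" using x by (simp add: rips_graph_def)
  have "h.scc_of z = h.scc_of x" if "z \<in> g.scc_of x" for z
  proof -
    have "reachable (rips_graph d \<epsilon>' (sublevel M f \<sigma>')) x z"
         "reachable (rips_graph d \<epsilon>' (sublevel M f \<sigma>')) z x"
      using that rips_graph_reachable_mono[OF m fs sub] le by (auto simp: g.scc_of_def)
    then show ?thesis unfolding h.scc_of_def by (blast intro: h.reachable_trans)
  qed
  moreover have "x \<in> g.scc_of x" using g.in_scc_of_self[OF xg] .
  ultimately have "(\<Union>z\<in>g.scc_of x. h.scc_of z) = h.scc_of x" by blast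
  then show ?thesis by (simp add: density_rips_def)
qed

lemma density_rips_obj:
  assumes "Metric_space M d" "finite M"
  shows "obj (density_rips M d f) (\<epsilon>, \<sigma>)
         = pre_digraph.scc_of (rips_graph d \<epsilon> (sublevel M f \<sigma>)) ` sublevel M f \<sigma>"
proof -
  have "finite (sublevel M f \<sigma>)" using assms by (simp add: sublevel_def)
  then interpret g: graph "rips_graph d \<epsilon> (sublevel M f \<sigma>)" using graph_rips_graph assms by blast
  show ?thesis by (simp add: density_rips_def g.sccs_verts_conv_scc_of) (simp add: rips_graph_def)
qed

lemma persistent_set_density_rips:
  assumes m: "Metric_space M d" and fin: "finite M"
  shows "persistent_set (density_rips M d f)"
proof -
  have sub: "x \<in> sublevel M f s'" if "x \<in> sublevel M f s" "s \<le> s'" for x s s'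
    using that by (auto simp: sublevel_def)
  have "{d x y | x y. x \<in> M \<and> y \<in> M} = (\<lambda>(x, y). d x y) ` (M \<times> M)" by auto
  then have 1: "finite (idx (density_rips M d f))" using fin by (simp add: density_rips_def)
  have 2: "finite (obj (density_rips M d f) p)" for p
    using fin by (cases p) (simp add: density_rips_obj[OF m fin] sublevel_def)
  show ?thesis
    unfolding persistent_set_def
    using 1 2 sub
    by (auto simp: density_rips_obj[OF m fin] density_rips_tr_scc_of[OF m fin])
qed

lemma bij_betw_point_generator:
  assumes m: "Metric_space M d" and fin: "finite M"
  shows "bij_betw (point_generator f) M (generators (density_rips M d f))"
proof -
  interpret Metric_space M d by fact
  let ?S = "density_rips M d f"
  let ?scc = "\<lambda>\<epsilon> \<sigma>. pre_digraph.scc_of (rips_graph d \<epsilon> (sublevel M f \<sigma>))"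
  have fs: "finite (sublevel M f s)" for s using fin by (simp add: sublevel_def)
  have idx: "(\<epsilon>, \<sigma>) \<in> idx ?S \<longleftrightarrow> (\<exists>x\<in>M. \<exists>y\<in>M. \<epsilon> = d x y) \<and> \<sigma> \<in> f ` M" for \<epsilon> \<sigma>
    by (auto simp: density_rips_def)
  have zero_idx: "(0, f x) \<in> idx ?S" if "x \<in> M" for x
    using that mdist_zero by (auto simp: idx intro!: bexI[of _ x])
  have self: "x \<in> ?scc \<epsilon> \<sigma> x" if "x \<in> sublevel M f \<sigma>" for x \<epsilon> \<sigma>
  proof -
    interpret g: graph "rips_graph d \<epsilon> (sublevel M f \<sigma>)" using graph_rips_graph[OF m fs] .
    show ?thesis using that by (intro g.in_scc_of_self) (simp add: rips_graph_def)
  qed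
  have scc0: "?scc 0 \<sigma> x = {x}" if x: "x \<in> sublevel M f \<sigma>" for x \<sigma>
  proof -
    interpret g: graph "rips_graph d 0 (sublevel M f \<sigma>)" using graph_rips_graph[OF m fs] .
    have "arcs (rips_graph d 0 (sublevel M f \<sigma>)) = {}"
      by (auto simp: rips_graph_def sublevel_def order_antisym_conv)
    then have "arcs_ends (rips_graph d 0 (sublevel M f \<sigma>)) = {}" by (simp add: arcs_ends_def)
    then have "y = x" if "y \<in> ?scc 0 \<sigma> x" for y
      using that reachable_rtranclI by (auto simp: g.scc_of_def)
    then show ?thesis using self[OF x] by blast
  qed
  have gen: "point_generator f x \<in> generators ?S" if x: "x \<in> M" for x
  proof -
    have xs: "x \<in> sublevel M f (f x)" using x by (simp add: sublevel_def)
    have "{x} \<in> obj ?S (0, f x)" using scc0[OF xs] xs by (force simp: density_rips_obj[OF m fin])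
    moreover have False
      if q: "q \<in> idx ?S" "q < (0, f x)" and t: "{x} \<in> tr ?S q (0, f x) ` obj ?S q" for q
    proof -
      obtain e s where qe: "q = (e, s)" by (cases q)
      obtain y where y: "y \<in> sublevel M f s" and eq: "{x} = tr ?S q (0, f x) (?scc e s y)"
        using t by (auto simp: qe density_rips_obj[OF m fin])
      have le: "(e, s) \<le> (0, f x)" using q(2) qe less_imp_le by blast
      have "{x} = ?scc 0 (f x) y" using eq density_rips_tr_scc_of[OF m fin le y] qe by simp
      moreover have "y \<in> sublevel M f (f x)" using y le by (auto simp: sublevel_def)
      ultimately have "x = y" using scc0 by auto
      then have "s = f x" using y le by (auto simp: sublevel_def)
      moreover have "e = 0" using q(1) le by (auto simp: qe idx order_antisym_conv)
      ultimately show False using q(2) qe by simp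
    qed
    ultimately show ?thesis using zero_idx[OF x] by (auto simp: generators_def point_generator_def)
  qed
  have "g \<in> point_generator f ` M" if g: "g \<in> generators ?S" for g
  proof -
    obtain e s C where ge: "g = ((e, s), C)" by (metis surj_pair)
    have es: "(e, s) \<in> idx ?S" and C: "C \<in> obj ?S (e, s)"
      and non: "\<And>q. q \<in> idx ?S \<Longrightarrow> q < (e, s) \<Longrightarrow> C \<notin> tr ?S q (e, s) ` obj ?S q"
      using g by (auto simp: generators_def ge)
    obtain y where y: "y \<in> sublevel M f s" and Cy: "C = ?scc e s y"
      using C by (auto simp: density_rips_obj[OF m fin])
    have yM: "y \<in> M" "f y \<le> s" using y by (auto simp: sublevel_def)
    have ys: "y \<in> sublevel M f (f y)" using yM by (simp add: sublevel_def)
    have le: "(0, f y) \<le> (e, s)" using es yM by (auto simp: idx)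
    have "C = tr ?S (0, f y) (e, s) (?scc 0 (f y) y)"
      using density_rips_tr_scc_of[OF m fin le ys] Cy by simp
    then have "C \<in> tr ?S (0, f y) (e, s) ` obj ?S (0, f y)"
      using ys by (auto simp: density_rips_obj[OF m fin])
    then have "(0, f y) = (e, s)" using non[OF zero_idx[OF yM(1)]] le by (auto simp: order.order_iff_strict)
    then show ?thesis using scc0[OF y] Cy yM(1) by (auto simp: ge point_generator_def)
  qed
  then show ?thesis using gen by (auto simp: bij_betw_def inj_on_def point_generator_def)
qed

end

theory Submission
  imports Defs
begin

text \<open>
  The components of the graph at \<open>(\<epsilon>, \<sigma>)\<close> are the images of the singletons \<open>{z}\<close> at
  \<open>(0, f z)\<close>, so by naturality an endomorphism of the density-Rips persistent set is known
  once its values on point generators are known (\<open>endomorphism_component\<close>).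

  Suppose that \<open>y\<close> satisfies (i) and (ii). Send the component \<open>{x}\<close>, wherever \<open>{x}\<close> is a
  component, to the component of \<open>y\<close>, and leave all other components alone. By (i), \<open>y\<close> is
  present whenever \<open>x\<close> is. By (ii), as soon as the component of \<open>x\<close> grows beyond \<open>{x}\<close> it is
  the component of \<open>y\<close>, so the map is natural. It is idempotent because the component of \<open>y\<close>
  is never \<open>{x}\<close>, and the only generator that it moves is that of \<open>x\<close>.

  Conversely, let \<open>\<phi>\<close> be an endomorphism that moves the generator of \<open>x\<close> and no other. Its
  value on \<open>{x}\<close> at \<open>(0, f x)\<close> is a singleton \<open>{y}\<close> with \<open>y \<noteq> x\<close> and \<open>f y \<le> f x\<close>. When \<open>x\<close> lies
  in the same component as some \<open>z \<noteq> x\<close>, naturality makes \<open>\<phi>\<close> send this component both to the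
  component of \<open>y\<close> (because it comes from \<open>x\<close>) and to that of \<open>z\<close> (because it comes from \<open>z\<close>,
  which is fixed). Hence \<open>x\<close>, \<open>y\<close> and \<open>z\<close> are connected. Condition (ii) concerns all real
  parameters and not only those in the index poset; \<open>rips_graph_at_index\<close> bridges this gap.
\<close>

section \<open>Components of the Rips graphs\<close>

locale augmented_metric_space = Metric_space M d
  for M :: "'a set" and d :: "'a \<Rightarrow> 'a \<Rightarrow> real" +
  fixes f :: "'a \<Rightarrow> real"
  assumes finite_points: "finite M"
begin

abbreviation rips :: "real \<Rightarrow> real \<Rightarrow> ('a, 'a \<times> 'a) pre_digraph" where
  "rips \<epsilon> \<sigma> \<equiv> rips_graph d \<epsilon> (sublevel M f \<sigma>)"

abbreviation component :: "real \<Rightarrow> real \<Rightarrow> 'a \<Rightarrow> 'a set" where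
  "component \<epsilon> \<sigma> \<equiv> pre_digraph.scc_of (rips \<epsilon> \<sigma>)"

abbreviation drips :: "(real \<times> real, 'a set) pset" where
  "drips \<equiv> density_rips M d f"

lemma metric: "Metric_space M d"
  by unfold_locales

lemma graph_rips: "graph (rips \<epsilon> \<sigma>)"
  using graph_rips_graph[OF metric] finite_points by (simp add: sublevel_def)

lemma self_in_component: "x \<in> sublevel M f \<sigma> \<Longrightarrow> x \<in> component \<epsilon> \<sigma> x"
proof -
  assume "x \<in> sublevel M f \<sigma>"
  interpret graph "rips \<epsilon> \<sigma>" by (rule graph_rips)
  show ?thesis
    using \<open>x \<in> sublevel M f \<sigma>\<close> by (intro in_scc_of_self) (simp add: rips_graph_def)
qed

lemma reachable_in_sublevel:
  assumes "reachable (rips \<epsilon> \<sigma>) x z"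
  shows "x \<in> sublevel M f \<sigma>" "z \<in> sublevel M f \<sigma>"
proof -
  interpret graph "rips \<epsilon> \<sigma>" by (rule graph_rips)
  show "x \<in> sublevel M f \<sigma>" "z \<in> sublevel M f \<sigma>"
    using reachable_in_verts[OF assms] by (simp_all add: rips_graph_def)
qed

lemma reachable_sym: "reachable (rips \<epsilon> \<sigma>) x z \<Longrightarrow> reachable (rips \<epsilon> \<sigma>) z x"
proof -
  interpret graph "rips \<epsilon> \<sigma>" by (rule graph_rips)
  show "reachable (rips \<epsilon> \<sigma>) x z \<Longrightarrow> reachable (rips \<epsilon> \<sigma>) z x"
    using symmetric_reachable[OF sym_arcs] .
qed

lemma in_component_iff: "z \<in> component \<epsilon> \<sigma> x \<longleftrightarrow> reachable (rips \<epsilon> \<sigma>) x z"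
  using reachable_sym by (auto simp: pre_digraph.scc_of_def)

lemma component_eq_iff:
  assumes "z \<in> sublevel M f \<sigma>"
  shows "component \<epsilon> \<sigma> x = component \<epsilon> \<sigma> z \<longleftrightarrow> reachable (rips \<epsilon> \<sigma>) x z"
proof -
  interpret graph "rips \<epsilon> \<sigma>" by (rule graph_rips)
  show ?thesis
  proof
    assume "component \<epsilon> \<sigma> x = component \<epsilon> \<sigma> z"
    then show "reachable (rips \<epsilon> \<sigma>) x z"
      using self_in_component[OF assms] in_component_iff by blast
  next
    assume "reachable (rips \<epsilon> \<sigma>) x z"
    then show "component \<epsilon> \<sigma> x = component \<epsilon> \<sigma> z"
      using reachable_trans reachable_sym unfolding set_eq_iff in_component_iff by blast
  qed
qed

lemma component_zero:
  assumes "x \<in> sublevel M f \<sigma>"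
  shows "component 0 \<sigma> x = {x}"
proof -
  have "arcs (rips 0 \<sigma>) = {}"
    by (auto simp: rips_graph_def sublevel_def order_antisym_conv)
  then have "arcs_ends (rips 0 \<sigma>) = {}" by (simp add: arcs_ends_def)
  then have "z = x" if "z \<in> component 0 \<sigma> x" for z
    using reachable_rtranclI[of "rips 0 \<sigma>" x z] that by (simp add: in_component_iff)
  then show ?thesis using self_in_component[OF assms] by blast
qed

section \<open>Endomorphisms on components of points\<close>

lemma idx_iff:
  "(\<epsilon>, \<sigma>) \<in> idx drips \<longleftrightarrow> (\<exists>x\<in>M. \<exists>y\<in>M. \<epsilon> = d x y) \<and> \<sigma> \<in> f ` M"
  by (auto simp: density_rips_def)

lemma idx_nonneg: "(\<epsilon>, \<sigma>) \<in> idx drips \<Longrightarrow> 0 \<le> \<epsilon>"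
  by (auto simp: idx_iff)

lemma birth_in_idx: "x \<in> M \<Longrightarrow> (0, f x) \<in> idx drips"
  using mdist_zero by (auto simp: idx_iff intro!: bexI[of _ x])

lemma singleton_in_obj: "x \<in> M \<Longrightarrow> {x} \<in> obj drips (0, f x)"
  using component_zero[of x "f x"]
  by (force simp: density_rips_obj[OF metric finite_points] sublevel_def)

lemma tr_singleton:
  assumes "z \<in> sublevel M f \<sigma>" "z \<in> sublevel M f \<sigma>'" "(0, \<sigma>) \<le> (\<epsilon>', \<sigma>')"
  shows "tr drips (0, \<sigma>) (\<epsilon>', \<sigma>') {z} = component \<epsilon>' \<sigma>' z"
  using density_rips_tr_scc_of[OF metric finite_points assms(3,1)]
  by (simp add: component_zero[OF assms(1)])

lemma generators_eq: "generators drips = point_generator f ` M"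
  using bij_betw_point_generator[OF metric finite_points] by (simp add: bij_betw_def)

text \<open>A component is the image of the generator of any of its points, so naturality transports
  the value of an endomorphism at a generator to every later component of that point.\<close>

lemma endomorphism_component:
  assumes \<phi>: "endomorphism drips \<phi>" and p: "(\<epsilon>, \<sigma>) \<in> idx drips"
    and x: "x \<in> sublevel M f \<sigma>" and y: "y \<in> sublevel M f (f x)"
    and \<phi>x: "\<phi> (0, f x) {x} = {y}"
  shows "\<phi> (\<epsilon>, \<sigma>) (component \<epsilon> \<sigma> x) = component \<epsilon> \<sigma> y"
proof -
  have xM: "x \<in> M" and fx: "f x \<le> \<sigma>" using x by (auto simp: sublevel_def)
  have x': "x \<in> sublevel M f (f x)" and y': "y \<in> sublevel M f \<sigma>"
    using xM fx y by (auto simp: sublevel_def)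
  have le: "(0, f x) \<le> (\<epsilon>, \<sigma>)" using idx_nonneg[OF p] fx by simp
  have "\<phi> (\<epsilon>, \<sigma>) (tr drips (0, f x) (\<epsilon>, \<sigma>) {x}) = tr drips (0, f x) (\<epsilon>, \<sigma>) (\<phi> (0, f x) {x})"
    using \<phi> p birth_in_idx[OF xM] singleton_in_obj[OF xM] le unfolding endomorphism_def by blast
  then show ?thesis
    using tr_singleton[OF x' x le] tr_singleton[OF y y' le] \<phi>x by simp
qed

text \<open>Rounding \<open>\<epsilon>\<close> and \<open>\<sigma>\<close> down to the nearest distance and the nearest value of \<open>f\<close> changes
  neither the points nor the edges of the graph. The hypotheses ensure that there is a value
  to round down to.\<close>

lemma rips_graph_at_index:
  assumes "0 \<le> \<epsilon>" and x: "x \<in> sublevel M f \<sigma>"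
  obtains \<epsilon>' \<sigma>' where "(\<epsilon>', \<sigma>') \<in> idx drips"
    "sublevel M f \<sigma>' = sublevel M f \<sigma>" "rips \<epsilon>' \<sigma>' = rips \<epsilon> \<sigma>"
proof -
  define E where "E = {e \<in> (\<lambda>(u, v). d u v) ` (M \<times> M). e \<le> \<epsilon>}"
  define F where "F = {s \<in> f ` M. s \<le> \<sigma>}"
  have xM: "x \<in> M" and fx: "f x \<le> \<sigma>" using x by (auto simp: sublevel_def)
  have finE: "finite E" and finF: "finite F" using finite_points by (auto simp: E_def F_def)
  have "d x x \<in> E" using xM assms(1) by (force simp: E_def)
  then have E: "Max E \<in> E" using finE by (auto intro: Max_in)
  have "f x \<in> F" using xM fx by (simp add: F_def)
  then have F: "Max F \<in> F" using finF by (auto intro: Max_in)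
  have level: "f u \<le> Max F \<longleftrightarrow> f u \<le> \<sigma>" if "u \<in> M" for u
    using F Max_ge[OF finF, of "f u"] that by (auto simp: F_def)
  have dist: "d u v \<le> Max E \<longleftrightarrow> d u v \<le> \<epsilon>" if "u \<in> M" "v \<in> M" for u v
    using E Max_ge[OF finE, of "d u v"] that by (force simp: E_def)
  have sub: "sublevel M f (Max F) = sublevel M f \<sigma>"
    using level by (auto simp: sublevel_def)
  have "rips (Max E) (Max F) = rips \<epsilon> \<sigma>"
    unfolding sub using dist by (auto simp: rips_graph_def sublevel_def)
  moreover have "(Max E, Max F) \<in> idx drips" using E F by (auto simp: idx_iff E_def F_def)
  ultimately show thesis using that sub by blast
qed

section \<open>Merging a point into another\<close>

definition merge_point :: "'a \<Rightarrow> 'a \<Rightarrow> real \<times> real \<Rightarrow> 'a set \<Rightarrow> 'a set" where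
  "merge_point x y = (\<lambda>(\<epsilon>, \<sigma>) C. if C = {x} then component \<epsilon> \<sigma> y else C)"

definition dominates :: "'a \<Rightarrow> 'a \<Rightarrow> bool" where
  "dominates y x \<longleftrightarrow> y \<in> M \<and> y \<noteq> x \<and> f y \<le> f x \<and>
     (\<forall>\<epsilon> \<sigma>. 0 \<le> \<epsilon> \<longrightarrow> (\<exists>z. z \<noteq> x \<and> reachable (rips \<epsilon> \<sigma>) x z) \<longrightarrow> reachable (rips \<epsilon> \<sigma>) x y)"

text \<open>Naturality is at stake only along a map that enlarges the component \<open>{x}\<close>; there the
  enlarged component already contains \<open>y\<close>. A component other than \<open>{x}\<close> contains a point
  \<open>w \<noteq> x\<close>, hence so do its images, and the map is the identity on all of them.\<close>

lemma idempotent_endomorphism_merge_point: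
  assumes dom: "dominates y x"
  shows "idempotent_endomorphism drips (merge_point x y)"
proof -
  have y: "y \<in> M" "y \<noteq> x" "f y \<le> f x"
    and near: "\<And>\<epsilon> \<sigma> z. 0 \<le> \<epsilon> \<Longrightarrow> z \<noteq> x \<Longrightarrow> reachable (rips \<epsilon> \<sigma>) x z \<Longrightarrow> reachable (rips \<epsilon> \<sigma>) x y"
    using dom unfolding dominates_def by blast+
  note obj = density_rips_obj[OF metric finite_points]
  have y_present: "y \<in> sublevel M f \<sigma>" if "{x} \<in> obj drips (\<epsilon>, \<sigma>)" for \<epsilon> \<sigma>
  proof -
    obtain z where z: "z \<in> sublevel M f \<sigma>" "{x} = component \<epsilon> \<sigma> z" using \<open>{x} \<in> _\<close> by (auto simp: obj)
    then have "z = x" using self_in_component[OF z(1), of \<epsilon>] by auto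
    then show ?thesis using z y by (auto simp: sublevel_def)
  qed
  have maps: "merge_point x y p C \<in> obj drips p" if C: "C \<in> obj drips p" for p C
  proof (cases p)
    case (Pair \<epsilon> \<sigma>)
    have "component \<epsilon> \<sigma> y \<in> obj drips p" if "C = {x}"
      using y_present[of \<epsilon> \<sigma>] C that by (simp add: Pair obj)
    then show ?thesis using C by (simp add: merge_point_def Pair)
  qed
  have natural: "merge_point x y q (tr drips p q C) = tr drips p q (merge_point x y p C)"
    if q: "q \<in> idx drips" and le: "p \<le> q" and C: "C \<in> obj drips p" for p q C
  proof -
    obtain \<epsilon> \<sigma> \<epsilon>' \<sigma>' where pq: "p = (\<epsilon>, \<sigma>)" "q = (\<epsilon>', \<sigma>')" by (metis surj_pair)
    note le' = le[unfolded pq]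
    obtain z where z: "z \<in> sublevel M f \<sigma>" and Cz: "C = component \<epsilon> \<sigma> z"
      using C by (auto simp: pq obj)
    have up: "u \<in> sublevel M f \<sigma>'" if "u \<in> sublevel M f \<sigma>" for u
      using that le' by (auto simp: sublevel_def)
    note tr_component = density_rips_tr_scc_of[OF metric finite_points le']
    show ?thesis
    proof (cases "C = {x}")
      case True
      then have zx: "z = x" using self_in_component[OF z, of \<epsilon>] Cz by auto
      have ys: "y \<in> sublevel M f \<sigma>" using y_present C True by (simp add: pq)
      (* Once the component of x has other points, condition (ii) puts y among them. *)
      have "component \<epsilon>' \<sigma>' x = component \<epsilon>' \<sigma>' y" if big: "component \<epsilon>' \<sigma>' x \<noteq> {x}"
      proof -
        obtain w where w: "w \<noteq> x" "w \<in> component \<epsilon>' \<sigma>' x"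
          using big self_in_component[OF up[OF z], of \<epsilon>'] zx by blast
        have "reachable (rips \<epsilon>' \<sigma>') x w" using w(2) by (simp add: in_component_iff)
        then have "reachable (rips \<epsilon>' \<sigma>') x y" using near[OF idx_nonneg w(1)] q pq by blast
        then show ?thesis by (simp add: component_eq_iff[OF up[OF ys]])
      qed
      then show ?thesis
        using True Cz zx tr_component[OF z, unfolded zx] tr_component[OF ys]
        by (simp add: merge_point_def pq)
    next
      case False
      then obtain w where w: "w \<in> C" "w \<noteq> x" using self_in_component[OF z, of \<epsilon>] Cz by auto
      then have r: "reachable (rips \<epsilon> \<sigma>) z w" by (simp add: Cz in_component_iff)
      then have "component \<epsilon> \<sigma> z = component \<epsilon> \<sigma> w" "w \<in> sublevel M f \<sigma>"
        using component_eq_iff reachable_in_sublevel by blast+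
      then have "w \<in> tr drips p q C"
        using tr_component self_in_component up by (simp add: Cz pq)
      then have "tr drips p q C \<noteq> {x}" using w by blast
      then show ?thesis using False by (simp add: merge_point_def pq)
    qed
  qed
  have idem: "merge_point x y p (merge_point x y p C) = merge_point x y p C"
    if C: "C \<in> obj drips p" for p C
  proof (cases p)
    case (Pair \<epsilon> \<sigma>)
    have "component \<epsilon> \<sigma> y \<noteq> {x}" if "C = {x}"
      using self_in_component[OF y_present, of \<epsilon> \<sigma> \<epsilon>] C that y(2) Pair by auto
    then show ?thesis by (auto simp: merge_point_def Pair)
  qed
  show ?thesis
    unfolding idempotent_endomorphism_def endomorphism_def using maps natural idem by blast
qed

section \<open>Rooted generators\<close>

lemma rooted_generator_if_dominates:
  assumes "x \<in> M" and dom: "dominates y x"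
  shows "rooted_generator drips (point_generator f x)"
proof -
  have y: "y \<in> sublevel M f (f x)" "y \<noteq> x" using dom by (auto simp: dominates_def sublevel_def)
  have fixed: "fixed_by (merge_point x y) (point_generator f z) \<longleftrightarrow> z \<noteq> x" for z
    using y(2) component_zero[OF y(1)]
    by (cases "z = x") (simp_all add: fixed_by_def point_generator_def merge_point_def)
  have moved: "{g \<in> generators drips. \<not> fixed_by (merge_point x y) g} = {point_generator f x}"
    using assms(1) fixed unfolding generators_eq by blast
  have "point_generator f x \<in> generators drips" using assms(1) by (simp add: generators_eq)
  then show ?thesis
    using idempotent_endomorphism_merge_point[OF dom] moved
    unfolding rooted_generator_def rooted_subset_def by blast
qed

text \<open>The point \<open>y\<close> is the one to which the endomorphism moves \<open>x\<close>: at \<open>(0, f x)\<close> every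
  component is a singleton, so the image of \<open>{x}\<close> names a point.\<close>

lemma dominates_if_rooted_generator:
  assumes x: "x \<in> M" and rooted: "rooted_generator drips (point_generator f x)"
  obtains y where "dominates y x"
proof -
  obtain \<phi> where \<phi>: "endomorphism drips \<phi>"
    and moved: "{g \<in> generators drips. \<not> fixed_by \<phi> g} = {point_generator f x}"
    using rooted unfolding rooted_generator_def rooted_subset_def idempotent_endomorphism_def by blast
  have \<phi>x: "\<phi> (0, f x) {x} \<noteq> {x}"
  proof -
    have "point_generator f x \<in> {g \<in> generators drips. \<not> fixed_by \<phi> g}" unfolding moved by simp
    then show ?thesis by (simp add: fixed_by_def point_generator_def)
  qed
  have \<phi>z: "\<phi> (0, f z) {z} = {z}" if z: "z \<in> M" "z \<noteq> x" for z
  proof -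
    have "point_generator f z \<notin> {g \<in> generators drips. \<not> fixed_by \<phi> g}"
      unfolding moved using z(2) by (simp add: point_generator_def)
    then show ?thesis using z(1) by (simp add: generators_eq fixed_by_def point_generator_def)
  qed
  have "\<phi> (0, f x) {x} \<in> obj drips (0, f x)"
    using \<phi> birth_in_idx[OF x] singleton_in_obj[OF x] unfolding endomorphism_def by blast
  then obtain y where y: "y \<in> sublevel M f (f x)" and \<phi>y: "\<phi> (0, f x) {x} = {y}"
    by (auto simp: density_rips_obj[OF metric finite_points] component_zero)
  have "reachable (rips \<epsilon> \<sigma>) x y"
    if "0 \<le> \<epsilon>" and z: "z \<noteq> x" and xz: "reachable (rips \<epsilon> \<sigma>) x z" for \<epsilon> \<sigma> z
  proof -
    note sub = reachable_in_sublevel[OF xz]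
    obtain \<epsilon>' \<sigma>' where p: "(\<epsilon>', \<sigma>') \<in> idx drips"
      and level: "sublevel M f \<sigma>' = sublevel M f \<sigma>" and graph: "rips \<epsilon>' \<sigma>' = rips \<epsilon> \<sigma>"
      using rips_graph_at_index[OF \<open>0 \<le> \<epsilon>\<close> sub(1)] by blast
    note sub' = sub[folded level]
    have zM: "z \<in> M" and zz: "z \<in> sublevel M f (f z)" using sub(2) by (auto simp: sublevel_def)
    have ys: "y \<in> sublevel M f \<sigma>'" using y sub'(1) by (auto simp: sublevel_def)
    have xz': "component \<epsilon>' \<sigma>' x = component \<epsilon>' \<sigma>' z"
      using component_eq_iff[OF sub'(2)] xz[folded graph] by blast
    (* Evaluating \<phi> on the common component from either point gives two expressions for it. *)
    have "component \<epsilon>' \<sigma>' y = \<phi> (\<epsilon>', \<sigma>') (component \<epsilon>' \<sigma>' x)"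
      by (rule endomorphism_component[OF \<phi> p sub'(1) y \<phi>y, symmetric])
    also have "\<dots> = component \<epsilon>' \<sigma>' z"
      unfolding xz' by (rule endomorphism_component[OF \<phi> p sub'(2) zz \<phi>z[OF zM z]])
    finally have "component \<epsilon>' \<sigma>' x = component \<epsilon>' \<sigma>' y" unfolding xz' by (rule sym)
    then have "reachable (rips \<epsilon>' \<sigma>') x y" using component_eq_iff[OF ys] by blast
    then show ?thesis unfolding graph .
  qed
  then have "dominates y x" using y \<phi>x \<phi>y by (auto simp: dominates_def sublevel_def)
  then show thesis by (rule that)
qed

end

theorem proposition3p4:
  fixes M :: "'a set" and d :: "'a \<Rightarrow> 'a \<Rightarrow> real" and f :: "'a \<Rightarrow> real" and x :: 'a
  assumes "Metric_space M d" and "finite M" and "x \<in> M"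
  shows "(\<exists>y\<in>M. y \<noteq> x \<and> f y \<le> f x \<and>
            (\<forall>\<epsilon> \<sigma>. 0 \<le> \<epsilon> \<longrightarrow>
               (\<exists>z. z \<noteq> x \<and> reachable (rips_graph d \<epsilon> (sublevel M f \<sigma>)) x z) \<longrightarrow>
               reachable (rips_graph d \<epsilon> (sublevel M f \<sigma>)) x y))
         \<longleftrightarrow> rooted_generator (density_rips M d f) (point_generator f x)"
proof -
  interpret augmented_metric_space M d f
    using assms(1,2) by (simp add: augmented_metric_space_def augmented_metric_space_axioms_def)
  have "(\<exists>y. dominates y x) \<longleftrightarrow> rooted_generator (density_rips M d f) (point_generator f x)"
    using rooted_generator_if_dominates[OF assms(3)] dominates_if_rooted_generator[OF assms(3)]
    by blast
  then show ?thesis unfolding dominates_def Bex_def .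
qed

end
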